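(* Let $k$ be a field of characteristic zero and let $B$ be a subalgebra of the $k$-algebra $S_2$ of codimension $1$. Then $B$ is the linear span of $z_1,z_2,z_3$ or the linear span of $z_1,z_2,z_4$.
   Context: Let $E_2$ be a $2$-dimensional $k$-vector space with basis $v_1,v_2$. Let $W_2$ be the vector space of all commutative (symmetric) bilinear maps $E_2\times E_2\to E_2$, with the (nonassociative) multiplication $$(A\cdot B)(x,y)=A(v_1,B(x,y))-B(A(v_1,x),y)-B(x,A(v_1,y)),\qquad x,y\in E_2.$$ $S_2$ is the subalgebra of $W_2$ consisting of those $A\in W_2$ such that for every $a\in E_2$ the linear map $T_a:E_2\to E_2$, $T_a(x)=A(a,x)$, has trace zero. For $i,j,m\in\{1,2\}$ let $\alpha_{ij}^m$ be the bilinear map with $\alpha_{ij}^m(v_t,v_l)=\delta_{it}\delta_{jl}v_m$. A basis of $S_2$ is $z_1=\alpha_{11}^1-\alpha_{12}^2-\alpha_{21}^2$, $z_2=\alpha_{12}^1+\alpha_{21}^1-\alpha_{22}^2$, $z_3=\alpha_{22}^1$, $z_4=\alpha_{11}^2$. A subalgebra is a linear subspace closed under the multiplication. *)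

theory Defs
  imports Complex_Main "HOL-Library.Function_Algebras"
begin

definition smul :: "('k \<Rightarrow> 'e \<Rightarrow> 'e) \<Rightarrow> 'k \<Rightarrow> ('e \<Rightarrow> 'e \<Rightarrow> 'e) \<Rightarrow> 'e \<Rightarrow> 'e \<Rightarrow> 'e" where
  "smul scale c A = (\<lambda>x y. scale c (A x y))"

text \<open>Only the vectors \<open>v 1\<close>, \<open>v 2\<close> matter; the values of \<open>v\<close> outside \<open>{1, 2}\<close> are irrelevant.\<close>

locale plane_basis = vector_space scale
  for scale :: "'k::field \<Rightarrow> 'e::ab_group_add \<Rightarrow> 'e" +
  fixes v :: "nat \<Rightarrow> 'e"
  assumes inj_basis: "inj_on v {1, 2}"
    and independent_basis: "independent (v ` {1, 2})"
    and span_basis: "span (v ` {1, 2}) = UNIV"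
begin

sublocale maps: vector_space "smul scale"
  by unfold_locales
    (simp_all add: smul_def fun_eq_iff scale_right_distrib scale_left_distrib)

definition coord :: "nat \<Rightarrow> 'e \<Rightarrow> 'k" where
  "coord i x = representation (v ` {1, 2}) x (v i)"

definition trace :: "('e \<Rightarrow> 'e) \<Rightarrow> 'k" where
  "trace T = (\<Sum>i\<in>{1, 2}. coord i (T (v i)))"

definition W2 :: "('e \<Rightarrow> 'e \<Rightarrow> 'e) set" where
  "W2 = {A. (\<forall>x. Vector_Spaces.linear scale scale (\<lambda>y. A x y)) \<and>
            (\<forall>y. Vector_Spaces.linear scale scale (\<lambda>x. A x y)) \<and>
            (\<forall>x y. A x y = A y x)}"

definition mult :: "('e \<Rightarrow> 'e \<Rightarrow> 'e) \<Rightarrow> ('e \<Rightarrow> 'e \<Rightarrow> 'e) \<Rightarrow> 'e \<Rightarrow> 'e \<Rightarrow> 'e" where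
  "mult A B = (\<lambda>x y. A (v 1) (B x y) - B (A (v 1) x) y - B x (A (v 1) y))"

definition S2 :: "('e \<Rightarrow> 'e \<Rightarrow> 'e) set" where
  "S2 = {A \<in> W2. \<forall>a. trace (\<lambda>x. A a x) = 0}"

definition subalgebra :: "('e \<Rightarrow> 'e \<Rightarrow> 'e) set \<Rightarrow> ('e \<Rightarrow> 'e \<Rightarrow> 'e) set \<Rightarrow> bool" where
  "subalgebra B S \<longleftrightarrow> B \<subseteq> S \<and> maps.subspace B \<and> (\<forall>A\<in>B. \<forall>C\<in>B. mult A C \<in> B)"

definition alpha :: "nat \<Rightarrow> nat \<Rightarrow> nat \<Rightarrow> 'e \<Rightarrow> 'e \<Rightarrow> 'e" where
  "alpha i j m = (\<lambda>x y. scale (coord i x * coord j y) (v m))"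

definition z1 :: "'e \<Rightarrow> 'e \<Rightarrow> 'e" where
  "z1 = alpha 1 1 1 - alpha 1 2 2 - alpha 2 1 2"

definition z2 :: "'e \<Rightarrow> 'e \<Rightarrow> 'e" where
  "z2 = alpha 1 2 1 + alpha 2 1 1 - alpha 2 2 2"

definition z3 :: "'e \<Rightarrow> 'e \<Rightarrow> 'e" where
  "z3 = alpha 2 2 1"

definition z4 :: "'e \<Rightarrow> 'e \<Rightarrow> 'e" where
  "z4 = alpha 1 1 2"

lemma coord_basis:
  assumes "i \<in> {1, 2}" "t \<in> {1, 2}"
  shows "coord i (v t) = (if i = t then 1 else 0)"
proof -
  have "v t \<in> v ` {1, 2}" using assms by blast
  then have "coord i (v t) = (if v i = v t then 1 else 0)"
    unfolding coord_def using representation_basis[OF independent_basis] by fastforce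
  then show ?thesis using assms inj_basis by (auto simp: inj_on_def)
qed

lemma coord_add: "coord i (x + y) = coord i x + coord i y"
  and coord_scale: "coord i (scale c x) = c * coord i x"
  using independent_basis span_basis
  by (simp_all add: coord_def representation_add representation_scale)

text \<open>\<open>alpha i j m\<close> is the bilinear map with the prescribed values on the basis.\<close>

lemma alpha_bilinear:
  "Vector_Spaces.linear scale scale (\<lambda>y. alpha i j m x y)"
  "Vector_Spaces.linear scale scale (\<lambda>x. alpha i j m x y)"
  by (simp_all add: Vector_Spaces.linear_iff vector_space_axioms alpha_def coord_add coord_scale
      algebra_simps)

lemma alpha_basis:
  assumes "{i, j, m, t, l} \<subseteq> {1, 2}"
  shows "alpha i j m (v t) (v l) = (if i = t \<and> j = l then v m else 0)"
  using assms by (simp add: alpha_def coord_basis)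

end

end

theory Submission
  imports Defs
begin

text \<open>
  Left multiplication by \<open>A\<close> involves \<open>A\<close> only through the trace-free endomorphism
  \<open>A (v 1)\<close>, which acts on bilinear maps in the natural way. So, in characteristic zero, \<open>S2\<close> is the four-dimensional
  irreducible representation of \<open>sl\<^sub>2\<close> (binary cubic forms), with weight vectors
  \<open>z4\<close>, \<open>z1\<close>, \<open>z2\<close>, \<open>z3\<close>, where \<open>z1\<close>, \<open>z2\<close>, \<open>z4\<close> act as the standard generators
  \<open>h\<close>, \<open>e\<close>, \<open>f\<close> and \<open>z3\<close> acts as zero. The resulting multiplication table is
  \<open>mult_combo\<close>.

  Let \<open>B\<close> be a subalgebra of codimension one. First, \<open>z3\<close> lies in \<open>B\<close>: otherwise \<open>B\<close> and \<open>z3\<close>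
  together span \<open>S2\<close>, so \<open>B\<close> contains some \<open>z2 - t z3\<close>, whose square is \<open>-3 z3\<close>.
  Secondly, no element of \<open>B\<close> has a \<open>z4\<close>-component: multiplying \<open>z3\<close> on the left by such an element
  produces \<open>z2\<close> modulo \<open>z3\<close>, multiplying \<open>z2\<close> in the same way produces \<open>z1\<close> modulo \<open>z2\<close> and \<open>z3\<close>, and
  then \<open>z4\<close> is in \<open>B\<close> as well, so that \<open>B\<close> is everything. Hence \<open>B\<close> is contained in the span of
  \<open>z1\<close>, \<open>z2\<close>, \<open>z3\<close>, and the codimension forces equality. Only the first of the two
  alternatives occurs, since \<open>mult z2 z2\<close> is \<open>-3 z3\<close>. Of the numerals, only \<open>2\<close> and
  \<open>3\<close> need to be inverted.
\<close>

section \<open>Subspaces of codimension one\<close>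

text \<open>The ambient space need not be finite-dimensional (bilinear maps are taken inside a space of
  all functions); the finite set \<open>X\<close> bounds the size of independent subsets of \<open>V\<close>. A basis of
  \<open>U\<close> together with \<open>x\<close> is independent and has \<open>dim V\<close> elements, hence spans \<open>V\<close>.\<close>

lemma (in vector_space) span_insert_codim_one:
  assumes U: "subspace U" and V: "subspace V" and UV: "U \<subseteq> V"
    and fin: "finite X" "V \<subseteq> span X"
    and codim: "dim V = dim U + 1"
    and x: "x \<in> V" "x \<notin> U"
  shows "span (insert x U) = V"
proof
  show "span (insert x U) \<subseteq> V"
    using V UV x by (simp add: span_minimal)
next
  obtain b where b: "b \<subseteq> U" "independent b" "U \<subseteq> span b" "card b = dim U"
    using basis_exists by blast
  obtain c where c: "c \<subseteq> V" "independent c" "V \<subseteq> span c" "card c = dim V"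
    using basis_exists by blast
  have finb: "finite b"
    using independent_span_bound[OF fin(1) b(2)] b(1) UV fin(2) by blast
  have finc: "finite c"
    using independent_span_bound[OF fin(1) c(2)] c(1) fin(2) by blast
  have "span b \<subseteq> U"
    using b(1) U by (simp add: span_minimal)
  then have xb: "x \<notin> span b"
    using x by blast
  then have ind: "independent (insert x b)"
    using b(2) by (simp add: independent_insert)
  have card: "card (insert x b) = dim V"
    using xb finb b(4) codim by (metis card_insert_disjoint span_base Suc_eq_plus1)
  show "V \<subseteq> span (insert x U)"
  proof
    fix y assume y: "y \<in> V"
    have "y \<in> span (insert x b)"
    proof (rule ccontr)
      assume yb: "y \<notin> span (insert x b)"
      then have "independent (insert y (insert x b))"
        using ind independent_insertI by blast
      moreover have "insert y (insert x b) \<subseteq> span c"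
        using y x b(1) UV c(3) by blast
      ultimately have "card (insert y (insert x b)) \<le> dim V"
        using independent_span_bound[OF finc] c(4) by metis
      moreover have "card (insert y (insert x b)) = Suc (dim V)"
        using yb finb card by (metis card_insert_disjoint finite_insert span_base)
      ultimately show False by simp
    qed
    then show "y \<in> span (insert x U)"
      using b(1) span_mono[of "insert x b" "insert x U"] by blast
  qed
qed

section \<open>Coordinates on the algebra\<close>

context plane_basis
begin

lemma coord_diff: "coord i (x - y) = coord i x - coord i y"
  using independent_basis span_basis by (simp add: coord_def representation_diff)

text \<open>The last three equations serve goals in which the simplifier has turned the index \<open>1\<close> into
  \<open>Suc 0\<close>.\<close>

lemma coord_v [simp]:
  "coord 1 (v 1) = 1" "coord 2 (v 2) = 1" "coord 1 (v 2) = 0" "coord 2 (v 1) = 0"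
  "coord (Suc 0) (v (Suc 0)) = 1" "coord (Suc 0) (v 2) = 0" "coord 2 (v (Suc 0)) = 0"
  by (simp_all add: coord_basis[simplified])

lemma coord_expansion: "x = scale (coord 1 x) (v 1) + scale (coord 2 x) (v 2)"
proof -
  have "x = (\<Sum>b\<in>v ` {1, 2}. scale (representation (v ` {1, 2}) x b) b)"
    using sum_representation_eq[OF independent_basis, of x "v ` {1, 2}"] span_basis by simp
  also have "\<dots> = (\<Sum>i\<in>{1, 2}. scale (coord i x) (v i))"
    unfolding coord_def by (rule sum.reindex_cong[OF inj_basis]) simp_all
  also have "\<dots> = scale (coord 1 x) (v 1) + scale (coord 2 x) (v 2)"
    by simp
  finally show ?thesis .
qed

lemma coord_eqI:
  assumes "coord 1 x = coord 1 y" "coord 2 x = coord 2 y"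
  shows "x = y"
  using coord_expansion[of x] coord_expansion[of y] assms by simp

lemma W2_expansion:
  assumes "A \<in> W2"
  shows "A x y = scale (coord 1 x * coord 1 y) (A (v 1) (v 1))
    + scale (coord 1 x * coord 2 y + coord 2 x * coord 1 y) (A (v 1) (v 2))
    + scale (coord 2 x * coord 2 y) (A (v 2) (v 2))"
proof -
  have add: "A (p + q) r = A p r + A q r" "A r (p + q) = A r p + A r q"
    and scale: "A (scale t p) r = scale t (A p r)" "A r (scale t p) = scale t (A r p)" for p q r t
    using assms by (simp_all add: W2_def Vector_Spaces.linear_iff)
  have sym: "A (v 2) (v 1) = A (v 1) (v 2)"
    using assms unfolding W2_def by blast
  have "A x y = A (scale (coord 1 x) (v 1) + scale (coord 2 x) (v 2))
      (scale (coord 1 y) (v 1) + scale (coord 2 y) (v 2))"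
    by (simp only: coord_expansion[symmetric])
  then show ?thesis
    unfolding add scale sym
    by (simp add: scale_right_distrib scale_left_distrib mult.commute add_ac)
qed

definition combo :: "'k \<Rightarrow> 'k \<Rightarrow> 'k \<Rightarrow> 'k \<Rightarrow> 'e \<Rightarrow> 'e \<Rightarrow> 'e" where
  "combo a b c d = smul scale a z1 + smul scale b z2 + smul scale c z3 + smul scale d z4"

lemma coord_combo:
  "coord 1 (combo a b c d x y) =
     a * (coord 1 x * coord 1 y) + b * (coord 1 x * coord 2 y + coord 2 x * coord 1 y)
     + c * (coord 2 x * coord 2 y)"
  "coord 2 (combo a b c d x y) =
     d * (coord 1 x * coord 1 y) - a * (coord 1 x * coord 2 y + coord 2 x * coord 1 y)
     - b * (coord 2 x * coord 2 y)"
  by (simp_all add: combo_def smul_def z1_def z2_def z3_def z4_def alpha_def coord_add coord_scale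
      coord_diff algebra_simps)

lemma combo_in_S2: "combo a b c d \<in> S2"
proof -
  have "combo a b c d \<in> W2"
    unfolding W2_def Vector_Spaces.linear_iff mem_Collect_eq
    by (intro conjI allI vector_space_axioms; rule coord_eqI;
        simp only: coord_combo coord_add coord_scale; simp add: algebra_simps)
  moreover have "trace (\<lambda>x. combo a b c d p x) = 0" for p
    by (simp add: trace_def coord_combo coord_combo[simplified] algebra_simps)
  ultimately show ?thesis
    by (simp add: S2_def)
qed

text \<open>Trace zero for \<open>A (v 1)\<close> and \<open>A (v 2)\<close> determines two of the six structure coefficients of
  a symmetric bilinear map; the other four are read off on the basis.\<close>

lemma S2_eq_combo:
  assumes "A \<in> S2"
  shows "A = combo (coord 1 (A (v 1) (v 1))) (coord 1 (A (v 1) (v 2)))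
    (coord 1 (A (v 2) (v 2))) (coord 2 (A (v 1) (v 1)))"
    (is "A = ?C")
proof -
  have W: "A \<in> W2" and tr: "trace (\<lambda>x. A p x) = 0" for p
    using assms by (auto simp: S2_def)
  have sym: "A (v 2) (v 1) = A (v 1) (v 2)"
    using W unfolding W2_def by blast
  have "coord 2 (A (v 1) (v 2)) = - coord 1 (A (v 1) (v 1))"
    using tr[of "v 1"] by (simp add: trace_def add_eq_0_iff)
  moreover have "coord 2 (A (v 2) (v 2)) = - coord 1 (A (v 1) (v 2))"
    using tr[of "v 2"] sym by (simp add: trace_def add_eq_0_iff)
  ultimately have "A x y = ?C x y" for x y
    by (subst W2_expansion[OF W], intro coord_eqI)
      (simp_all only: coord_combo coord_add coord_scale, simp_all add: algebra_simps)
  then show ?thesis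
    by (intro ext)
qed

lemma combo_in_subspace:
  assumes "maps.subspace U" "z1 \<in> U" "z2 \<in> U" "z3 \<in> U" "z4 \<in> U"
  shows "combo a b c d \<in> U"
  unfolding combo_def using assms by (intro maps.subspace_add maps.subspace_scale)

lemma z_eq_combo:
  "z1 = combo 1 0 0 0" "z2 = combo 0 1 0 0" "z3 = combo 0 0 1 0" "z4 = combo 0 0 0 1"
  by (simp_all add: combo_def)

lemma combo_add: "combo a b c d + combo a' b' c' d' = combo (a + a') (b + b') (c + c') (d + d')"
  by (simp add: combo_def maps.scale_left_distrib add_ac)

lemma combo_scale: "smul scale t (combo a b c d) = combo (t * a) (t * b) (t * c) (t * d)"
  by (simp add: combo_def maps.scale_right_distrib)

lemma S2_eq_span: "S2 = maps.span {z1, z2, z3, z4}"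
proof
  show "S2 \<subseteq> maps.span {z1, z2, z3, z4}"
  proof
    fix A assume "A \<in> S2"
    then show "A \<in> maps.span {z1, z2, z3, z4}"
      by (subst S2_eq_combo) (simp_all add: combo_in_subspace maps.span_base)
  qed
  have "maps.subspace S2"
  proof (rule maps.subspaceI)
    have "combo 0 0 0 0 = 0" by (simp add: combo_def)
    then show "0 \<in> S2" using combo_in_S2 by metis
  next
    fix A C assume "A \<in> S2" "C \<in> S2"
    then show "A + C \<in> S2" by (metis S2_eq_combo combo_add combo_in_S2)
  next
    fix t A assume "A \<in> S2"
    then show "smul scale t A \<in> S2" by (metis S2_eq_combo combo_scale combo_in_S2)
  qed
  then show "maps.span {z1, z2, z3, z4} \<subseteq> S2"
    by (intro maps.span_minimal) (auto simp: z_eq_combo combo_in_S2)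
qed

section \<open>The multiplication table\<close>

text \<open>The matrix of \<open>combo a b c d (v 1)\<close> has rows \<open>(a, b)\<close> and \<open>(d, -a)\<close>; the
  product depends on the left factor through this matrix alone, so \<open>c\<close> does not occur on the
  right, and the diagonal part \<open>a\<close> scales the four coefficients by their weights
  \<open>-1\<close>, \<open>1\<close>, \<open>3\<close>, \<open>-3\<close>.\<close>

lemma mult_combo:
  "mult (combo a b c d) (combo a' b' c' d') =
   combo (- a * a' + b * d' - 2 * d * b') (a * b' - 2 * b * a' - d * c')
     (3 * a * c' - 3 * b * b') (- 3 * a * d' + 3 * d * a')"
proof (intro ext coord_eqI)
  fix x y
  show "coord 1 (mult (combo a b c d) (combo a' b' c' d') x y) = coord 1 (combo
     (- a * a' + b * d' - 2 * d * b') (a * b' - 2 * b * a' - d * c')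
     (3 * a * c' - 3 * b * b') (- 3 * a * d' + 3 * d * a') x y)"
    unfolding mult_def coord_diff coord_combo coord_v by algebra
  show "coord 2 (mult (combo a b c d) (combo a' b' c' d') x y) = coord 2 (combo
     (- a * a' + b * d' - 2 * d * b') (a * b' - 2 * b * a' - d * c')
     (3 * a * c' - 3 * b * b') (- 3 * a * d' + 3 * d * a') x y)"
    unfolding mult_def coord_diff coord_combo coord_v by algebra
qed

section \<open>Subalgebras of codimension one\<close>

lemma subspace_scale_cancel:
  assumes "maps.subspace U" "smul scale t A \<in> U" "t \<noteq> 0"
  shows "A \<in> U"
  using maps.subspace_scale[OF assms(1,2), of "inverse t"] assms(3) by simp

text \<open>The \<open>z4\<close>-component of a map is the second coordinate of its value at \<open>(v 1, v 1)\<close>.\<close>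

lemma z4_notin_span: "z4 \<notin> maps.span {z1, z2, z3}"
proof
  let ?K = "{A. coord 2 (A (v 1) (v 1)) = 0}"
  have coord_0: "coord 2 0 = 0"
    using coord_scale[of 2 0 0] by simp
  have "maps.subspace ?K"
    by (rule maps.subspaceI) (simp_all add: smul_def coord_add coord_scale coord_0)
  then have "maps.span {z1, z2, z3} \<subseteq> ?K"
    by (intro maps.span_minimal) (simp_all add: z_eq_combo coord_combo[simplified])
  moreover assume "z4 \<in> maps.span {z1, z2, z3}"
  ultimately show False
    by (auto simp: z_eq_combo coord_combo[simplified])
qed

text \<open>A complement of the line through \<open>z3\<close> meets the coset of \<open>z2\<close>, and every element of that
  coset has the same square \<open>-3 z3\<close>, because \<open>z3\<close> acts as zero and \<open>z2\<close> annihilates \<open>z3\<close>.\<close>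

lemma z3_in_codim_one_subalgebra:
  assumes B: "subalgebra B S2" and codim: "maps.dim S2 = maps.dim B + 1"
    and three: "(3::'k) \<noteq> 0"
  shows "z3 \<in> B"
proof (rule ccontr)
  assume z3: "z3 \<notin> B"
  have sub: "maps.subspace B" and "B \<subseteq> S2" and closed: "\<And>A C. A \<in> B \<Longrightarrow> C \<in> B \<Longrightarrow> mult A C \<in> B"
    using B by (auto simp: subalgebra_def)
  have "maps.span (insert z3 B) = S2"
    using sub \<open>B \<subseteq> S2\<close> codim z3
    by (intro maps.span_insert_codim_one[where X = "{z1, z2, z3, z4}"])
      (auto simp: S2_eq_span intro: maps.span_base)
  then have "z2 \<in> maps.span (insert z3 B)"
    by (simp add: z_eq_combo combo_in_S2)
  then obtain t where "z2 - smul scale t z3 \<in> maps.span B"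
    by (auto simp: maps.span_breakdown_eq)
  then have "z2 - smul scale t z3 \<in> B"
    using sub maps.span_eq_iff by blast
  moreover have "z2 - smul scale t z3 = combo 0 1 (- t) 0"
    by (simp add: combo_def)
  ultimately have "combo 0 1 (- t) 0 \<in> B"
    by simp
  from closed[OF this this] have "smul scale (- 3) z3 \<in> B"
    by (simp add: mult_combo z_eq_combo(3) combo_scale)
  then show False
    using subspace_scale_cancel[OF sub] three z3 by (metis neg_equal_0_iff_equal)
qed

text \<open>The element with \<open>d \<noteq> 0\<close> acts as a lowering operator up to terms of weight no smaller: starting
  from the highest weight vector \<open>z3\<close>, it reaches \<open>z2\<close> and \<open>z1\<close> modulo vectors already obtained.
  Removing the components along these from the element itself leaves \<open>d z4\<close>.\<close>

lemma subalgebra_eq_S2: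
  assumes B: "subalgebra B S2" and z3: "z3 \<in> B"
    and A: "combo a b c d \<in> B" and d: "d \<noteq> 0" and two: "(2::'k) \<noteq> 0"
  shows "B = S2"
proof -
  have sub: "maps.subspace B" and "B \<subseteq> S2" and closed: "\<And>A C. A \<in> B \<Longrightarrow> C \<in> B \<Longrightarrow> mult A C \<in> B"
    using B by (auto simp: subalgebra_def)
  note comb = maps.subspace_add[OF sub] maps.subspace_diff[OF sub] maps.subspace_scale[OF sub]
  have "smul scale (3 * a) z3 - mult (combo a b c d) z3 \<in> B"
    using closed[OF A z3] z3 by (intro comb)
  moreover have "smul scale (3 * a) z3 - mult (combo a b c d) z3 = smul scale d z2"
    unfolding z_eq_combo(3) mult_combo by (simp add: combo_def)
  ultimately have z2: "z2 \<in> B"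
    using subspace_scale_cancel[OF sub _ d] by simp
  have "smul scale a z2 - smul scale (3 * b) z3 - mult (combo a b c d) z2 \<in> B"
    using closed[OF A z2] z2 z3 by (intro comb)
  moreover have "smul scale a z2 - smul scale (3 * b) z3 - mult (combo a b c d) z2
      = smul scale (2 * d) z1"
    unfolding z_eq_combo(2) mult_combo by (simp add: combo_def)
  ultimately have z1: "z1 \<in> B"
    using subspace_scale_cancel[OF sub] d two by simp
  have "combo a b c d - (smul scale a z1 + smul scale b z2 + smul scale c z3) \<in> B"
    using A z1 z2 z3 by (intro comb)
  then have z4: "z4 \<in> B"
    using subspace_scale_cancel[OF sub _ d] by (simp add: combo_def)
  have "S2 \<subseteq> B"
    unfolding S2_eq_span using sub z1 z2 z3 z4 by (intro maps.span_minimal) auto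
  then show ?thesis
    using \<open>B \<subseteq> S2\<close> by blast
qed

theorem codim_one_subalgebra_eq_span:
  assumes B: "subalgebra B S2" and codim: "maps.dim S2 = maps.dim B + 1"
    and two: "(2::'k) \<noteq> 0" and three: "(3::'k) \<noteq> 0"
  shows "B = maps.span {z1, z2, z3}"
proof -
  have sub: "maps.subspace B" and BS: "B \<subseteq> S2"
    using B by (auto simp: subalgebra_def)
  have z3: "z3 \<in> B"
    using z3_in_codim_one_subalgebra[OF B codim three] .
  have le: "B \<subseteq> maps.span {z1, z2, z3}"
  proof
    fix A assume A: "A \<in> B"
    then obtain a b c d where eq: "A = combo a b c d"
      using S2_eq_combo BS by blast
    have "B \<noteq> S2"
      using codim by auto
    then have "d = 0"
      using subalgebra_eq_S2[OF B z3 _ _ two] A eq by blast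
    then have "A = smul scale a z1 + smul scale b z2 + smul scale c z3"
      by (simp add: eq combo_def)
    then show "A \<in> maps.span {z1, z2, z3}"
      by (simp add: maps.span_add maps.span_scale maps.span_base)
  qed
  \<comment> \<open>A further element of the span would, together with \<open>B\<close>, span all of \<open>S2\<close>, including \<open>z4\<close>.\<close>
  have "maps.span {z1, z2, z3} \<subseteq> B"
  proof (rule ccontr)
    assume "\<not> maps.span {z1, z2, z3} \<subseteq> B"
    then obtain x where x: "x \<in> maps.span {z1, z2, z3}" "x \<notin> B"
      by blast
    have "maps.span {z1, z2, z3} \<subseteq> S2"
      unfolding S2_eq_span by (intro maps.span_mono) blast
    then have "maps.span (insert x B) = S2"
      using sub BS codim x
      by (intro maps.span_insert_codim_one[where X = "{z1, z2, z3, z4}"]) (auto simp: S2_eq_span)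
    moreover have "maps.span (insert x B) \<subseteq> maps.span {z1, z2, z3}"
      using x le by (intro maps.span_minimal) auto
    moreover have "z4 \<in> S2"
      by (simp add: z_eq_combo combo_in_S2)
    ultimately show False
      using z4_notin_span by blast
  qed
  with le show ?thesis
    by blast
qed

end

theorem theorem8:
  fixes scale :: "'k::field_char_0 \<Rightarrow> 'e::ab_group_add \<Rightarrow> 'e"
    and v :: "nat \<Rightarrow> 'e"
    and B :: "('e \<Rightarrow> 'e \<Rightarrow> 'e) set"
  assumes "plane_basis scale v"
    and "plane_basis.subalgebra scale v B (plane_basis.S2 scale v)"
    and "vector_space.dim (smul scale) (plane_basis.S2 scale v) = vector_space.dim (smul scale) B + 1"
  shows "B = module.span (smul scale)
              {plane_basis.z1 scale v, plane_basis.z2 scale v, plane_basis.z3 scale v} \<or>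
         B = module.span (smul scale)
              {plane_basis.z1 scale v, plane_basis.z2 scale v, plane_basis.z4 scale v}"
  using plane_basis.codim_one_subalgebra_eq_span[OF assms] by simp

end
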